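(* Let $r=\sin(\pi/12)/(1-\sin(\pi/12))$. The compact packing of the plane using discs of radius $1$ and $r$ is unique up to translations, rotations and reflections: any two compact packings of the plane using discs of radius $1$ and $r$ are images of one another under an isometry of the plane.
   Context: A packing of the plane is a collection of closed discs in $\mathbb{R}^2$ with pairwise disjoint interiors. A packing is compact if for every disc $D$ of the packing, the discs of the packing tangent to $D$, listed in cyclic order around $D$ as $D_1,\dots,D_n$ (with $D_{n+1}=D_1$), are such that $D_i$ is tangent to $D_{i+1}$ for $i=1,\dots,n$, and this chain surrounds $D$: the angles, in $(0,\pi)$, at the centre of $D$ in the triangles with vertices the centres of $D,D_i,D_{i+1}$ sum to $2\pi$. A compact packing using discs of radius $1$ and $r$ is a compact packing in which every disc has radius $1$ or $r$ and discs of both radii occur. *)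

theory Defs
  imports "HOL-Analysis.Analysis"
begin

text \<open>The plane is \<^typ>\<open>complex\<close>. A disc is given by its centre and its radius; the point set
  is \<open>disc_set\<close>. For positive radii the two descriptions determine each other.\<close>

type_synonym disc = "complex \<times> real"

abbreviation centre :: "disc \<Rightarrow> complex" where
  "centre D \<equiv> fst D"

abbreviation radius :: "disc \<Rightarrow> real" where
  "radius D \<equiv> snd D"

definition disc_set :: "disc \<Rightarrow> complex set" where
  "disc_set D = cball (centre D) (radius D)"

definition packing :: "disc set \<Rightarrow> bool" where
  "packing P \<longleftrightarrow>
     (\<forall>D\<in>P. 0 < radius D) \<and>
     pairwise (\<lambda>D E. interior (disc_set D) \<inter> interior (disc_set E) = {}) P"

text \<open>External tangency, the only kind possible for discs with disjoint interiors. A disc of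
  positive radius is not tangent to itself.\<close>

definition tangent :: "disc \<Rightarrow> disc \<Rightarrow> bool" where
  "tangent D E \<longleftrightarrow> dist (centre D) (centre E) = radius D + radius E"

definition tangent_discs :: "disc set \<Rightarrow> disc \<Rightarrow> disc set" where
  "tangent_discs P D = {E \<in> P. tangent D E}"

text \<open>Counterclockwise order of the directions from \<open>D\<close>, measured from the first disc of the list.
  As \<open><\<close> is strict and \<^const>\<open>Arg2pi\<close> has values in \<open>[0, 2\<pi>)\<close>, the list is distinct and runs
  around \<open>D\<close> once.\<close>

definition cyclically_ordered :: "disc \<Rightarrow> disc list \<Rightarrow> bool" where
  "cyclically_ordered D Es \<longleftrightarrow>
     sorted_wrt (<) (map (\<lambda>E. Arg2pi ((centre E - centre D) / (centre (hd Es) - centre D))) Es)"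

text \<open>The angle at \<open>a\<close> of the triangle \<open>a b c\<close>, in \<open>[0, \<pi>]\<close>. For the centres of three mutually
  tangent discs of positive radius the triangle is nondegenerate, so the value is in \<open>(0, \<pi>)\<close>.\<close>

definition triangle_angle :: "complex \<Rightarrow> complex \<Rightarrow> complex \<Rightarrow> real" where
  "triangle_angle a b c = arccos (((b - a) \<bullet> (c - a)) / (norm (b - a) * norm (c - a)))"

text \<open>The condition below does not depend on the starting disc or on the sense of rotation of the
  listing. In particular the number of tangent discs is finite.\<close>

definition compact_packing :: "disc set \<Rightarrow> bool" where
  "compact_packing P \<longleftrightarrow> packing P \<and>
     (\<forall>D\<in>P. \<exists>Es. set Es = tangent_discs P D \<and> cyclically_ordered D Es \<and>
        (\<forall>i<length Es. tangent (Es ! i) (Es ! (Suc i mod length Es))) \<and>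
        (\<Sum>i<length Es. triangle_angle (centre D) (centre (Es ! i))
                           (centre (Es ! (Suc i mod length Es)))) = 2 * pi)"

definition compact_packing_using :: "real \<Rightarrow> real \<Rightarrow> disc set \<Rightarrow> bool" where
  "compact_packing_using s r P \<longleftrightarrow>
     compact_packing P \<and>
     (\<forall>D\<in>P. radius D = s \<or> radius D = r) \<and>
     (\<exists>D\<in>P. radius D = s) \<and> (\<exists>D\<in>P. radius D = r)"

definition plane_isometry :: "(complex \<Rightarrow> complex) \<Rightarrow> bool" where
  "plane_isometry f \<longleftrightarrow> bij f \<and> (\<forall>x y. dist (f x) (f y) = dist x y)"

end

theory Submission
  imports Defs
begin

text \<open>Write \<open>\<zeta> = exp (\<i>\<pi>/6)\<close>. Let \<open>\<beta> = arccos (1 - sin (\<pi>/12))\<close>, which lies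
  between 42 and 42.5 degrees. The triangle angles are 60 (three equal discs), 30 (two small discs at a large one) and 75 degrees (a small and
  a large disc at a small one); at a large disc the mixed angle is \<open>\<beta>\<close>, at a small disc two
  large ones span \<open>\<pi> - 2\<beta>\<close>. By the bounds on \<open>\<beta>\<close>, angles adding up to \<open>2\<pi>\<close> cannot involve it, so a large disc has
  6 large or 12 small neighbours, and a small disc has 6 small ones or the corona
  large, small, large, small, small. Two touching large discs, or a small disc touching only small
  ones, force a hexagonal lattice of equal discs that leaves no room for a disc of the other
  radius. Hence every large disc is surrounded by 12 small ones with centres
  \<open>c + s \<zeta>\<^sup>k\<close>; by the corona of the small discs, consecutive pairs of this ring
  alternately touch a further large disc, the reflection of the given one. So \<open>c\<close> and \<open>s\<close>
  determine the large centres as a lattice, and then all the small discs.\<close>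

section \<open>Coronas\<close>

lemma sum_periodic_shift:
  fixes f :: "nat \<Rightarrow> real"
  assumes "\<And>i. f (i + n) = f i"
  shows "(\<Sum>i<n. f (i + k)) = (\<Sum>i<n. f i)"
proof (induction k)
  case (Suc k)
  have "(\<Sum>i<Suc n. f (i + k)) = f k + (\<Sum>i<n. f (Suc i + k))"
    by (subst sum.lessThan_Suc_shift) simp
  moreover have "(\<Sum>i<Suc n. f (i + k)) = (\<Sum>i<n. f (i + k)) + f k"
    using assms[of k] by (simp add: add.commute)
  ultimately show ?case using Suc by simp
qed simp

lemma arccos_cos_le:
  assumes "0 \<le> x" shows "arccos (cos x) \<le> x"
proof (cases "x \<le> pi")
  case True
  then show ?thesis using assms by (simp add: arccos_cos)
next
  case False
  then show ?thesis using arccos_ubound[of "cos x"] by simp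
qed

lemma triangle_angle_sgn:
  assumes "b \<noteq> a" "sgn (b - a) = cis x * w" "sgn (c - a) = cis y * w" "c \<noteq> a"
  shows "triangle_angle a b c = arccos (cos (y - x))"
proof -
  have w: "norm w = 1"
    using assms(1,2) norm_sgn[of "b - a"] by (simp add: norm_mult)
  have "((b - a) \<bullet> (c - a)) / (norm (b - a) * norm (c - a)) = sgn (b - a) \<bullet> sgn (c - a)"
    unfolding sgn_div_norm inner_scaleR_left inner_scaleR_right by (simp add: divide_simps)
  also have "\<dots> = (norm w)\<^sup>2 * cos (y - x)"
    unfolding assms cmod_power2 by (simp add: inner_complex_def cos_diff power2_eq_square algebra_simps)
  finally show ?thesis using w by (simp add: triangle_angle_def)
qed

text \<open>Turns the unoriented angles into counterclockwise rotations: since they total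
  \<open>2 * pi\<close>, no gap between consecutive directions can exceed \<open>pi\<close>.\<close>

lemma corona_from_start:
  assumes P: "packing P" and D: "D \<in> P"
    and Es: "set Es = tangent_discs P D" "cyclically_ordered D Es"
    and ang: "(\<Sum>i<length Es. triangle_angle (centre D) (centre (Es ! i))
                           (centre (Es ! (Suc i mod length Es)))) = 2 * pi"
    and i: "i < length Es"
  shows "sgn (centre (Es ! (Suc i mod length Es)) - centre D) =
     cis (triangle_angle (centre D) (centre (Es ! i)) (centre (Es ! (Suc i mod length Es))))
       * sgn (centre (Es ! i) - centre D)"
proof -
  define n where "n = length Es"
  define v where "v i = centre (Es ! (i mod n)) - centre D" for i
  \<comment> \<open>At \<open>i = n\<close> the walk is back at the first disc; the value
    \<open>2 * pi\<close> instead of 0 makes the increments telescope to a full turn.\<close>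
  define a where "a i = (if i < n then Arg2pi (v i / v 0) else 2 * pi)" for i
  have n: "n > 0" using i unfolding n_def by linarith
  have hd: "hd Es = Es ! 0" using i by (cases Es) simp_all
  have v0: "v i \<noteq> 0" for i
  proof -
    have "Es ! (i mod n) \<in> tangent_discs P D"
      using n Es(1) by (metis mod_less_divisor n_def nth_mem)
    then have "dist (centre D) (centre (Es ! (i mod n))) > 0"
      using P D by (auto simp: tangent_discs_def tangent_def packing_def intro!: add_pos_pos)
    then show ?thesis by (auto simp: v_def)
  qed
  have va: "v i = of_real (norm (v i)) * cis (a i) * sgn (v 0)" if "i \<le> n" for i
  proof (cases "i < n")
    case True
    have "v i / v 0 = of_real (norm (v i / v 0)) * cis (a i)"
      using Arg2pi_eq[of "v i / v 0"] True by (simp add: a_def cis_conv_exp)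
    then show ?thesis using v0[of 0] by (simp add: sgn_eq norm_divide field_simps)
  next
    case False
    then have "i = n" using that by simp
    moreover have "v n = v 0" by (simp add: v_def)
    ultimately show ?thesis using v0[of 0] by (simp add: a_def sgn_eq)
  qed
  have sg: "sgn (v i) = cis (a i) * sgn (v 0)" if "i \<le> n" for i
    using va[OF that] v0[of i] v0[of 0] by (subst sgn_eq) (simp add: field_simps)
  have t: "triangle_angle (centre D) (centre (Es ! i)) (centre (Es ! (Suc i mod n)))
      = arccos (cos (a (Suc i) - a i))" if "i < n" for i
  proof (rule triangle_angle_sgn)
    show "sgn (centre (Es ! i) - centre D) = cis (a i) * sgn (v 0)"
      using sg[of i] that by (simp add: v_def)
    show "sgn (centre (Es ! (Suc i mod n)) - centre D) = cis (a (Suc i)) * sgn (v 0)"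
      using sg[of "Suc i"] that by (simp add: v_def)
    show "centre (Es ! i) \<noteq> centre D" using v0[of i] that by (simp add: v_def)
    show "centre (Es ! (Suc i mod n)) \<noteq> centre D" using v0[of "Suc i"] by (simp add: v_def)
  qed
  have inc: "a i \<le> a (Suc i)" if "i < n" for i
  proof (cases "Suc i < n")
    case True
    have "sorted_wrt (<) (map (\<lambda>E. Arg2pi ((centre E - centre D) / v 0)) Es)"
      using Es(2) by (simp add: cyclically_ordered_def hd v_def)
    from sorted_wrt_nth_less[OF this, of i "Suc i"] True
    have "Arg2pi (v i / v 0) < Arg2pi (v (Suc i) / v 0)" by (simp add: n_def v_def)
    then show ?thesis using True by (simp add: a_def)
  next
    case False
    then show ?thesis using that Arg2pi_lt_2pi[of "v i / v 0"] by (simp add: a_def less_imp_le)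
  qed
  \<comment> \<open>Each triangle angle is at most the increment of the argument, and both total \<open>2\<pi>\<close>, so
    they agree.\<close>
  have tot: "(\<Sum>i<n. a (Suc i) - a i) = 2 * pi"
    using n v0[of 0] by (subst sum_lessThan_telescope) (simp add: a_def Arg2pi_of_real[of 1, simplified])
  have "arccos (cos (a (Suc i) - a i)) = a (Suc i) - a i"
  proof (rule sum_mono_inv[where I = "{..<n}" and f = "\<lambda>i. arccos (cos (a (Suc i) - a i))"])
    show "(\<Sum>i<n. arccos (cos (a (Suc i) - a i))) = (\<Sum>i<n. a (Suc i) - a i)"
      using ang tot t by (simp flip: n_def)
  qed (use i inc in \<open>auto simp: n_def intro: arccos_cos_le\<close>)
  then have "sgn (v (Suc i)) = cis (arccos (cos (a (Suc i) - a i))) * sgn (v i)"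
    using sg[of "Suc i"] sg[of i] i by (simp add: n_def cis_mult flip: mult.assoc)
  then show ?thesis using t[of i] i by (simp add: v_def n_def)
qed

text \<open>The list is rotated to begin at \<open>E\<close> and continued periodically, so that a
  walk around \<open>D\<close> can start at any neighbour and needs no wrap-around.\<close>

lemma corona:
  assumes P: "compact_packing P" and D: "D \<in> P" and E: "E \<in> tangent_discs P D"
  obtains n g where "n > 0" "g 0 = E" "\<And>i. g (i + n) = g i" "range g = tangent_discs P D"
    "\<And>i. tangent (g i) (g (Suc i))"
    "\<And>i. sgn (centre (g (Suc i)) - centre D) =
       cis (triangle_angle (centre D) (centre (g i)) (centre (g (Suc i)))) * sgn (centre (g i) - centre D)"
    "(\<Sum>i<n. triangle_angle (centre D) (centre (g i)) (centre (g (Suc i)))) = 2 * pi"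
proof -
  obtain Es where Es: "set Es = tangent_discs P D" "cyclically_ordered D Es"
    and tan: "\<And>i. i < length Es \<Longrightarrow> tangent (Es ! i) (Es ! (Suc i mod length Es))"
    and ang: "(\<Sum>i<length Es. triangle_angle (centre D) (centre (Es ! i))
                           (centre (Es ! (Suc i mod length Es)))) = 2 * pi"
    using P D unfolding compact_packing_def by blast
  define n where "n = length Es"
  obtain k where k: "k < n" "Es ! k = E" using E Es(1) by (metis in_set_conv_nth n_def)
  then have n: "n > 0" by simp
  define h where "h i = Es ! (i mod n)" for i
  define g where "g i = h (i + k)" for i
  have h_Suc: "Es ! (Suc (i mod n) mod n) = h (Suc i)" for i by (simp add: h_def mod_Suc_eq)
  have rot: "sgn (centre (h (Suc i)) - centre D) =
       cis (triangle_angle (centre D) (centre (h i)) (centre (h (Suc i)))) * sgn (centre (h i) - centre D)" for i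
    using corona_from_start[OF _ D Es ang, of "i mod n"] P n h_Suc[of i]
    by (simp add: compact_packing_def n_def h_def)
  show thesis
  proof (rule that[of n g])
    show "n > 0" by fact
    show "g 0 = E" using k by (simp add: g_def h_def)
    show "g (i + n) = g i" for i by (simp add: g_def h_def flip: add.assoc) (metis add.assoc add.commute mod_add_self2)
    show "range g = tangent_discs P D"
    proof
      show "range g \<subseteq> tangent_discs P D"
        using n by (auto simp: g_def h_def n_def simp flip: Es(1))
      show "tangent_discs P D \<subseteq> range g"
      proof
        fix F assume "F \<in> tangent_discs P D"
        then obtain j where j: "j < n" "Es ! j = F" using Es(1) by (metis in_set_conv_nth n_def)
        have "(j + (n - k) + k) mod n = j" using j k by simp
        then have "g (j + (n - k)) = F" using j by (simp add: g_def h_def)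
        then show "F \<in> range g" by blast
      qed
    qed
    show "tangent (g i) (g (Suc i))" for i
      using tan[of "(i + k) mod n"] n h_Suc[of "i + k"] by (simp add: g_def h_def n_def)
    show "sgn (centre (g (Suc i)) - centre D) =
       cis (triangle_angle (centre D) (centre (g i)) (centre (g (Suc i)))) * sgn (centre (g i) - centre D)" for i
      using rot[of "i + k"] by (simp add: g_def)
    have per: "h (i + n) = h i" for i by (simp add: h_def)
    have "(\<Sum>i<n. triangle_angle (centre D) (centre (g i)) (centre (g (Suc i))))
        = (\<Sum>i<n. triangle_angle (centre D) (centre (h i)) (centre (h (Suc i))))"
      using sum_periodic_shift[of "\<lambda>i. triangle_angle (centre D) (centre (h i)) (centre (h (Suc i)))" n k]
        per per[of "Suc i" for i] by (simp add: g_def)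
    also have "\<dots> = 2 * pi" using ang by (simp add: h_def n_def)
    finally show "(\<Sum>i<n. triangle_angle (centre D) (centre (g i)) (centre (g (Suc i)))) = 2 * pi" .
  qed
qed

section \<open>The hexagonal lattice\<close>

abbreviation \<zeta> :: complex where "\<zeta> \<equiv> cis (pi / 6)"

lemma zeta_power_6: "\<zeta> ^ 6 = -1"
  by (subst Complex.DeMoivre) (simp add: complex_eq_iff)

lemma zeta_square: "\<zeta> ^ 2 = Complex (1 / 2) (sqrt 3 / 2)"
  by (subst Complex.DeMoivre) (simp add: complex_eq_iff cos_60 sin_60)

text \<open>\<open>\<zeta>^2\<close> is a turn by 60 degrees, so the points reached form the
  triangular lattice spanned by \<open>u\<close> and \<open>u * \<zeta>^2\<close>.\<close>

lemma lattice_closed: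
  fixes A :: "complex \<Rightarrow> bool"
  assumes "A c" and step: "\<And>z. A z \<Longrightarrow> A (z + u) \<and> A (z - u) \<and> A (z + u * \<zeta>^2) \<and> A (z - u * \<zeta>^2)"
  shows "A (c + u * (of_int m + of_int n * \<zeta>^2))"
proof -
  have "A (c + u * of_int m)"
  proof (induction m rule: int_induct[where k = 0])
    case base show ?case using assms(1) by simp
  next
    case (step1 i) then show ?case using step[OF step1(2)] by (simp add: algebra_simps)
  next
    case (step2 i) then show ?case using step[OF step2(2)] by (simp add: algebra_simps)
  qed
  then show ?thesis
  proof (induction n rule: int_induct[where k = 0])
    case base then show ?case by simp
  next
    case (step1 i) then show ?case using step[OF step1(2)[OF step1(3)]] by (simp add: algebra_simps)
  next
    case (step2 i) then show ?case using step[OF step2(2)[OF step2(3)]] by (simp add: algebra_simps)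
  qed
qed

lemma round_error: "\<exists>m::int. (x - of_int m)\<^sup>2 \<le> 1 / (4::real)"
proof
  have "\<bar>x - of_int (round x)\<bar> \<le> 1 / 2"
    using of_int_round_abs_le[of x] by (simp add: abs_minus_commute)
  then have "\<bar>x - of_int (round x)\<bar>\<^sup>2 \<le> (1 / 2)\<^sup>2" by (intro power_mono) auto
  then show "(x - of_int (round x))\<^sup>2 \<le> 1 / 4" by (simp add: power2_eq_square)
qed

text \<open>Rounding to the nearest row and then within that row is not optimal (the covering radius
  squared is \<open>1 / 3\<close>) but suffices.\<close>

lemma lattice_cover:
  assumes "u \<noteq> 0"
  shows "\<exists>m n. (norm (w - (c + u * (of_int m + of_int n * \<zeta>^2))))\<^sup>2 \<le> 7 / 16 * (norm u)\<^sup>2"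
proof -
  define q where "q = (w - c) / u"
  obtain n :: int where n: "(2 * Im q / sqrt 3 - of_int n)\<^sup>2 \<le> 1 / 4" using round_error by blast
  obtain m :: int where m: "(Re q - of_int n / 2 - of_int m)\<^sup>2 \<le> 1 / 4" using round_error by blast
  have s: "sqrt 3 * sqrt 3 = 3" by simp
  \<comment> \<open>Rows are \<open>sqrt 3 / 2\<close> apart, so the vertical error contributes at
    most \<open>3 / 4 * (1 / 4)\<close>; with \<open>1 / 4\<close> from within the row this gives
    \<open>7 / 16\<close>.\<close>
  have "(Im q - of_int n * sqrt 3 / 2)\<^sup>2 = 3 / 4 * (2 * Im q / sqrt 3 - of_int n)\<^sup>2"
    using s by (simp add: power2_eq_square field_simps)
  with m n have "(norm (q - (of_int m + of_int n * \<zeta>^2)))\<^sup>2 \<le> 7 / 16"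
    unfolding zeta_square cmod_power2 by (simp add: algebra_simps)
  then have "(norm u)\<^sup>2 * (norm (q - (of_int m + of_int n * \<zeta>^2)))\<^sup>2 \<le> (norm u)\<^sup>2 * (7 / 16)"
    by (intro mult_left_mono) auto
  moreover have "w - (c + u * (of_int m + of_int n * \<zeta>^2)) = u * (q - (of_int m + of_int n * \<zeta>^2))"
    using assms by (simp add: q_def field_simps)
  ultimately have "(norm (w - (c + u * (of_int m + of_int n * \<zeta>^2))))\<^sup>2 \<le> 7 / 16 * (norm u)\<^sup>2"
    by (simp add: norm_mult power_mult_distrib)
  then show ?thesis by blast
qed

text \<open>A pair of points differing by \<open>u\<close> can be moved to every neighbouring
  lattice point by two turns, so \<open>M\<close> contains the whole lattice generated by
  \<open>u\<close>.\<close>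

lemma hexagonal_closed_cover:
  fixes M :: "complex set"
  assumes "z \<in> M" "z + u \<in> M" "u \<noteq> 0"
    and rot: "\<And>z v k. z \<in> M \<Longrightarrow> z + v \<in> M \<Longrightarrow> norm v = norm u \<Longrightarrow> z + v * \<zeta> ^ (2 * k) \<in> M"
  shows "\<exists>x\<in>M. (norm (w - x))\<^sup>2 \<le> 7 / 16 * (norm u)\<^sup>2"
proof -
  define A where "A z \<longleftrightarrow> z \<in> M \<and> z + u \<in> M" for z
  have turn: "A (z + u * \<zeta> ^ (2 * j))" if "A z" "j \<le> 6" for z j
  proof -
    have 1: "z + u * \<zeta> ^ (2 * j) \<in> M" using rot[of z u j] that by (simp add: A_def)
    \<comment> \<open>The vector back to \<open>z\<close> is turned until it equals
      \<open>u\<close>. The total exponent 18 is an odd multiple of 6, so it cancels the sign, and 9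
      keeps \<open>9 - j\<close> a true difference.\<close>
    have "z + u * \<zeta> ^ (2 * j) + (- u * \<zeta> ^ (2 * j)) * \<zeta> ^ (2 * (9 - j)) \<in> M"
      using rot[of "z + u * \<zeta> ^ (2 * j)" "- u * \<zeta> ^ (2 * j)" "9 - j"] that 1
      by (simp add: A_def norm_mult norm_power)
    moreover have "\<zeta> ^ (2 * j) * \<zeta> ^ (2 * (9 - j)) = -1"
    proof -
      have "\<zeta> ^ (2 * j) * \<zeta> ^ (2 * (9 - j)) = \<zeta> ^ (6 * 3)"
        using that(2) by (subst power_add[symmetric], intro arg_cong[where f = "(^) \<zeta>"]) simp
      then show ?thesis unfolding power_mult zeta_power_6 by simp
    qed
    ultimately have "z + u * \<zeta> ^ (2 * j) + u \<in> M" by (simp add: mult.assoc)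
    with 1 show ?thesis by (simp add: A_def)
  qed
  have "\<zeta> ^ 8 = - (\<zeta> ^ 2)" using power_add[of \<zeta> 6 2] zeta_power_6 by simp
  then have "A (c + u) \<and> A (c - u) \<and> A (c + u * \<zeta>^2) \<and> A (c - u * \<zeta>^2)" if "A c" for c
    using turn[OF that, of 0] turn[OF that, of 3] turn[OF that, of 1] turn[OF that, of 4] zeta_power_6
    by simp
  moreover have "A z" using assms by (simp add: A_def)
  ultimately have "A (z + u * (of_int m + of_int n * \<zeta>^2))" for m n
    by (rule lattice_closed[rotated])
  then show ?thesis using lattice_cover[OF assms(3), of w z] by (metis A_def)
qed

section \<open>Angles\<close>

lemma sin_pi_12_square: "(sin (pi / 12))\<^sup>2 = (2 - sqrt 3) / 4"
proof -
  have "cos (2 * (pi / 12)) = sqrt 3 / 2" using cos_30 by simp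
  then show ?thesis unfolding cos_double_sin by (simp add: field_simps)
qed

lemma sin_pi_12_bounds: "0.2588 < sin (pi / 12)" "sin (pi / 12) < 0.2589"
proof -
  have s: "1.732 < sqrt 3" "sqrt 3 < 1.73207"
    by (rule real_less_rsqrt real_less_lsqrt; simp add: power2_eq_square)+
  have p: "sin (pi / 12) > 0" by (rule sin_gt_zero) auto
  have "(0.2588::real)\<^sup>2 < (sin (pi / 12))\<^sup>2"
    unfolding sin_pi_12_square using s by (simp add: power2_eq_square)
  then show "0.2588 < sin (pi / 12)" using p power2_less_imp_less by fastforce
  have "(sin (pi / 12))\<^sup>2 < (0.2589::real)\<^sup>2"
    unfolding sin_pi_12_square using s by (simp add: power2_eq_square)
  then show "sin (pi / 12) < 0.2589" by (rule power2_less_imp_less) simp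
qed

text \<open>The angle at a disc of radius \<open>1\<close> between tangent discs of radii \<open>1\<close> and \<open>r\<close>,
  approximately 42.17 degrees.\<close>

definition mixed_angle :: real where "mixed_angle = arccos (1 - sin (pi / 12))"

lemma cos_mixed_angle: "cos mixed_angle = 1 - sin (pi / 12)"
  unfolding mixed_angle_def using sin_pi_12_bounds by (intro cos_arccos) auto

lemma mixed_angle_range: "0 < mixed_angle" "mixed_angle < pi / 4"
proof -
  have r: "0 \<le> mixed_angle" "mixed_angle \<le> pi"
    unfolding mixed_angle_def using sin_pi_12_bounds by (auto intro!: arccos_lbound arccos_ubound)
  have "mixed_angle \<noteq> 0" using cos_mixed_angle sin_pi_12_bounds by auto
  then show "0 < mixed_angle" using r by simp
  have "sqrt 2 < 1.42" by (rule real_less_lsqrt) (simp_all add: power2_eq_square)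
  then have "cos (pi / 4) < cos mixed_angle" using cos_mixed_angle sin_pi_12_bounds by (simp add: cos_45)
  then show "mixed_angle < pi / 4" using r by (subst (asm) cos_mono_less_eq) auto
qed

text \<open>Multiplication by 5 takes \<open>7 * pi / 30\<close> to \<open>7 * pi / 6\<close>, whose
  cosine is known exactly, while \<open>cos (5 * b)\<close> is the Chebyshev polynomial of degree 5
  in \<open>cos b\<close>, which the decimal bounds control.\<close>

lemma mixed_angle_lower: "7 * pi / 30 < mixed_angle"
proof (rule ccontr)
  assume contra: "\<not> ?thesis"
  define b where "b = mixed_angle"
  define x where "x = cos b"
  have b: "0 < b" "b \<le> 7 * pi / 30" using mixed_angle_range contra by (auto simp: b_def)
  have x: "0.7411 < x" "x < 0.7412" using cos_mixed_angle sin_pi_12_bounds by (auto simp: x_def b_def)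
  have s2: "(sin b)\<^sup>2 = 1 - x\<^sup>2" by (simp add: x_def sin_squared_eq)
  have "cos (5 * b) = cos (2 * (2 * b)) * cos b - sin (2 * (2 * b)) * sin b"
    by (simp flip: cos_add)
  also have "\<dots> = (2 * (2 * x\<^sup>2 - 1)\<^sup>2 - 1) * x - 4 * x * (2 * x\<^sup>2 - 1) * (sin b)\<^sup>2"
    unfolding cos_double_cos sin_double x_def by (simp add: power2_eq_square)
  also have "\<dots> = 16 * x ^ 5 - 20 * x ^ 3 + 5 * x"
    unfolding s2 by (simp add: algebra_simps power2_eq_square eval_nat_numeral)
  finally have c5: "cos (5 * b) = 16 * x ^ 5 - 20 * x ^ 3 + 5 * x" .
  have "0.7411 ^ 5 \<le> x ^ 5" "x ^ 3 \<le> 0.7412 ^ 3" using x by (auto intro!: power_mono)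
  then have "cos (5 * b) > - 0.863" unfolding c5 using x by (simp add: power_divide)
  moreover have "cos (7 * pi / 6) = - (sqrt 3 / 2)"
  proof -
    have "cos (7 * pi / 6) = cos (pi / 6 + pi)" by (rule arg_cong[where f = cos]) simp
    then show ?thesis by (simp only: cos_periodic_pi cos_30)
  qed
  moreover have "sqrt 3 > 1.73" by (rule real_less_rsqrt) (simp add: power2_eq_square)
  ultimately have gt: "cos (5 * b) > cos (7 * pi / 6)" by simp
  show False
  \<comment> \<open>Beyond \<open>pi\<close> the cosine increases, so that branch is reflected to
    \<open>2 * pi - 5 * b\<close>. In the other, \<open>pi / 6 < b\<close> puts \<open>5 * b\<close>
    above \<open>5 * pi / 6\<close>, where the cosine is too small.\<close>
  proof (cases "5 * b \<le> pi")
    case True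
    have "cos b < cos (pi / 6)" using x \<open>sqrt 3 > 1.73\<close> by (simp add: cos_30 flip: x_def)
    then have "pi / 6 < b" using b by (subst (asm) cos_mono_less_eq) auto
    then have "cos (5 * b) < cos (pi - pi / 6)" using True by (subst cos_mono_less_eq) auto
    moreover have "cos (pi - pi / 6) = - (sqrt 3 / 2)" by (simp only: cos_pi_minus cos_30)
    ultimately show False using gt \<open>cos (7 * pi / 6) = _\<close> by linarith
  next
    case False
    have "cos (2 * pi - 5 * b) > cos (2 * pi - 7 * pi / 6)"
      using gt by (simp only: cos_2pi_minus)
    then show False using b False by (subst (asm) cos_mono_less_eq) auto
  qed
qed

text \<open>Factor 6 takes \<open>17 * pi / 72\<close> to \<open>17 * pi / 12\<close>, with cosine
  \<open>- sin (pi / 12)\<close>; it is applied as doubling, then tripling.\<close>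

lemma mixed_angle_upper: "mixed_angle < 17 * pi / 72"
proof (rule ccontr)
  assume contra: "\<not> ?thesis"
  define b where "b = mixed_angle"
  define y where "y = cos (2 * b)"
  have b: "17 * pi / 72 \<le> b" "b < pi / 4" using mixed_angle_range contra by (auto simp: b_def)
  have x: "0.7411 < cos b" "cos b < 0.7412" using cos_mixed_angle sin_pi_12_bounds by (auto simp: b_def)
  have "0.7411 * 0.7411 \<le> cos b * cos b" "cos b * cos b \<le> 0.7412 * 0.7412"
    using x by (intro mult_mono; simp)+
  then have y: "0.098 < y" "y < 0.099" by (auto simp: y_def cos_double_cos power2_eq_square)
  have "y ^ 3 \<le> 0.099 ^ 3" using y by (auto intro!: power_mono)
  moreover have "cos (3 * (2 * b)) = 4 * y ^ 3 - 3 * y" by (simp only: y_def cos_treble_cos)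
  ultimately have "cos (6 * b) < - 0.2589" using y by (simp add: power_divide)
  moreover have "cos (17 * pi / 12) = - sin (pi / 12)"
  proof -
    have "cos (17 * pi / 12) = cos ((pi / 2 - pi / 12) + pi)" by (rule arg_cong[where f = cos]) simp
    then show ?thesis by (simp only: cos_periodic_pi cos_diff cos_pi_half sin_pi_half mult_zero_left mult_1 add_0)
  qed
  ultimately have "cos (6 * b) < cos (17 * pi / 12)" using sin_pi_12_bounds by simp
  then have "cos (2 * pi - 6 * b) < cos (2 * pi - 17 * pi / 12)" by (simp only: cos_2pi_minus)
  then show False using b by (subst (asm) cos_mono_less_eq) auto
qed

text \<open>In half degrees the angles are 120, 60 and a value strictly between 84 and 85, and the
  total is 720. For \<open>c\<close> from 1 to 8 no multiple of 60 lies strictly between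
  \<open>720 - 85 * c\<close> and \<open>720 - 84 * c\<close>; for \<open>c = 5\<close> the upper
  end 300 is just excluded.\<close>

lemma large_count:
  fixes a b c :: nat
  assumes "a * (pi / 3) + b * (pi / 6) + c * mixed_angle = 2 * pi"
  shows "c = 0"
proof -
  define x where "x = mixed_angle / pi"
  have x: "7 / 30 < x" "x < 17 / 72" using mixed_angle_lower mixed_angle_upper by (auto simp: x_def field_simps)
  have "(a / 3 + b / 6 + c * x) * pi = 2 * pi" using assms by (simp add: x_def algebra_simps)
  then have eq: "a / 3 + b / 6 + c * x = 2" by simp
  show ?thesis
  proof (rule ccontr)
    assume "c \<noteq> 0"
    then have "c * (7 / 30) < c * x" "c * x < c * (17 / 72)" using x by simp_all
    then have "real (60 * (2 * a + b) + 84 * c) < real 720" "real 720 < real (60 * (2 * a + b) + 85 * c)"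
      using eq by simp_all
    moreover define k where "k = 2 * a + b"
    ultimately have k: "60 * k + 84 * c < 720" "720 < 60 * k + 85 * c"
      by (simp_all only: of_nat_less_iff)
    then have "c < 9" by linarith
    have s: "k \<le> m \<or> m + 1 \<le> k" for m by linarith
    from \<open>c < 9\<close> consider "c = 1" | "c = 2" | "c = 3" | "c = 4" | "c = 5" | "c = 6" | "c = 7" | "c = 8"
      using \<open>c \<noteq> 0\<close> by linarith
    then show False
    proof cases
      case 1 then show ?thesis using k s[of 10] by auto
    next
      case 2 then show ?thesis using k s[of 9] by auto
    next
      case 3 then show ?thesis using k s[of 7] by auto
    next
      case 4 then show ?thesis using k s[of 6] by auto
    next
      case 5 then show ?thesis using k s[of 4] by auto
    next
      case 6 then show ?thesis using k s[of 3] by auto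
    next
      case 7 then show ?thesis using k s[of 2] by auto
    next
      case 8 then show ?thesis using k s[of 0] by auto
    qed
  qed
qed

text \<open>In degrees the angles are 60, 75 and a value strictly between 95 and 96. For
  \<open>c\<close> from 1 to 3 no multiple of 15 fits the remainder; then
  \<open>4 * a + 5 * b = 24\<close> has only the solutions (6, 0) and (1, 4).\<close>

lemma small_count:
  fixes a b c :: nat
  assumes "a * (pi / 3) + b * (5 * pi / 12) + c * (pi - 2 * mixed_angle) = 2 * pi"
  shows "c = 0" "b = 0 \<or> a = 1"
proof -
  define x where "x = 1 - 2 * mixed_angle / pi"
  have x: "19 / 36 < x" "x < 16 / 30" using mixed_angle_lower mixed_angle_upper by (auto simp: x_def field_simps)
  have "(a / 3 + b * 5 / 12 + c * x) * pi = 2 * pi" using assms by (simp add: x_def algebra_simps)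
  then have eq: "a / 3 + b * 5 / 12 + c * x = 2" by simp
  show c: "c = 0"
  proof (rule ccontr)
    assume "c \<noteq> 0"
    then have "c * (19 / 36) < c * x" "c * x < c * (16 / 30)" using x by simp_all
    then have "real (15 * (4 * a + 5 * b) + 95 * c) < real 360" "real 360 < real (15 * (4 * a + 5 * b) + 96 * c)"
      using eq by simp_all
    moreover define k where "k = 4 * a + 5 * b"
    ultimately have k: "15 * k + 95 * c < 360" "360 < 15 * k + 96 * c"
      by (simp_all only: of_nat_less_iff)
    then have "c < 4" by linarith
    have s: "k \<le> m \<or> m + 1 \<le> k" for m by linarith
    from \<open>c < 4\<close> consider "c = 1" | "c = 2" | "c = 3"
      using \<open>c \<noteq> 0\<close> by linarith
    then show False
    proof cases
      case 1 then show ?thesis using k s[of 17] by auto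
    next
      case 2 then show ?thesis using k s[of 11] by auto
    next
      case 3 then show ?thesis using k s[of 4] by auto
    qed
  qed
  have "real (4 * a + 5 * b) = real 24" using eq c by simp
  then have "4 * a + 5 * b = 24" unfolding of_nat_eq_iff .
  then show "b = 0 \<or> a = 1" by presburger
qed

text \<open>Otherwise the point dividing the segment of centres in the ratio of the radii is
  interior to both discs.\<close>

lemma packing_separated:
  assumes "packing P" "D \<in> P" "E \<in> P" "D \<noteq> E"
  shows "radius D + radius E \<le> dist (centre D) (centre E)"
proof (rule ccontr)
  assume contra: "\<not> ?thesis"
  define a where "a = radius D"
  define b where "b = radius E"
  define v where "v = centre E - centre D"
  have pos: "a > 0" "b > 0" using assms by (auto simp: packing_def a_def b_def)
  have less: "norm v < a + b" using contra by (simp add: v_def a_def b_def dist_norm norm_minus_commute)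
  define q where "q = a / (a + b)"
  have q: "0 < q" "q < 1" "q * (a + b) = a" "(1 - q) * (a + b) = b"
    using pos by (simp_all add: q_def field_simps)
  define p where "p = centre D + of_real q * v"
  have "dist (centre D) p = q * norm v"
    using q by (simp add: p_def dist_norm norm_mult)
  also have "\<dots> < q * (a + b)" using less q(1) by (rule mult_strict_left_mono)
  finally have 1: "p \<in> ball (centre D) a" using q by simp
  have "centre E - p = of_real (1 - q) * v"
    by (simp add: p_def v_def algebra_simps)
  then have "dist (centre E) p = (1 - q) * norm v"
    using q by (simp add: dist_norm norm_mult del: of_real_diff)
  also have "\<dots> < (1 - q) * (a + b)" using less q(2) by (intro mult_strict_left_mono) auto
  finally have 2: "p \<in> ball (centre E) b" using q by simp
  have "interior (disc_set D) \<inter> interior (disc_set E) = {}"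
    using assms by (auto simp: packing_def pairwise_def)
  then show False using 1 2 by (auto simp: disc_set_def a_def b_def)
qed

text \<open>The law of cosines for the triangle with sides \<open>R + a\<close>,
  \<open>R + b\<close>, \<open>a + b\<close> spanned by three mutually tangent discs.\<close>

definition corona_angle :: "real \<Rightarrow> real \<Rightarrow> real \<Rightarrow> real" where
  "corona_angle R a b = arccos (((R + a)\<^sup>2 + (R + b)\<^sup>2 - (a + b)\<^sup>2) / (2 * (R + a) * (R + b)))"

lemma triangle_angle_tangent:
  assumes "tangent D E" "tangent D F" "tangent E F"
  shows "triangle_angle (centre D) (centre E) (centre F) = corona_angle (radius D) (radius E) (radius F)"
proof -
  have n: "norm (centre E - centre D) = radius D + radius E" "norm (centre F - centre D) = radius D + radius F"
    "norm (centre E - centre D - (centre F - centre D)) = radius E + radius F"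
    using assms by (simp_all add: tangent_def dist_norm norm_minus_commute)
  show ?thesis
    unfolding triangle_angle_def dot_norm_neg n corona_angle_def by (simp add: algebra_simps)
qed

section \<open>Packings by discs of radii 1 and r\<close>

locale two_radius_packing =
  fixes r :: real and P :: "disc set"
  assumes r_def: "r = sin (pi / 12) / (1 - sin (pi / 12))"
    and P: "compact_packing_using 1 r P"
begin

lemma r_bounds: "0 < r" "r < 1" "1.349 < 1 + r" "1 + r < 1.35"
  using sin_pi_12_bounds by (simp_all add: r_def field_simps)

lemma cos_mixed_angle_r: "cos mixed_angle = 1 / (1 + r)"
  and sin_pi_12_r: "sin (pi / 12) = r / (1 + r)"
  using sin_pi_12_bounds unfolding cos_mixed_angle by (simp_all add: r_def field_simps)

section \<open>Angles of triangles of tangent discs with radii 1 and \<open>r\<close>\<close>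

lemma corona_angle_same: "0 < R \<Longrightarrow> corona_angle R R R = pi / 3"
proof -
  assume "0 < R"
  then have "((R + R)\<^sup>2 + (R + R)\<^sup>2 - (R + R)\<^sup>2) / (2 * (R + R) * (R + R)) = cos (pi / 3)"
    by (simp add: cos_60 field_simps power2_eq_square)
  then show ?thesis unfolding corona_angle_def by (simp only:) (rule arccos_cos; simp)
qed

lemma corona_angle_large_mixed: "corona_angle 1 1 r = mixed_angle" "corona_angle 1 r 1 = mixed_angle"
proof -
  have "((1 + 1)\<^sup>2 + (1 + r)\<^sup>2 - (1 + r)\<^sup>2) / (2 * (1 + 1) * (1 + r)) = cos mixed_angle"
    "((1 + r)\<^sup>2 + (1 + 1)\<^sup>2 - (r + 1)\<^sup>2) / (2 * (1 + r) * (1 + 1)) = cos mixed_angle"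
    using r_bounds by (simp_all add: cos_mixed_angle_r field_simps power2_eq_square)
  then show "corona_angle 1 1 r = mixed_angle" "corona_angle 1 r 1 = mixed_angle"
    unfolding corona_angle_def using mixed_angle_range by (simp_all add: arccos_cos)
qed

text \<open>Half of this angle has sine \<open>r / (1 + r)\<close>, and \<open>r\<close> is the
  value for which this is \<open>sin (pi / 12)\<close>: twelve small discs close up around a large
  one.\<close>

lemma corona_angle_large_small: "corona_angle 1 r r = pi / 6"
proof -
  have "cos (pi / 6) = cos (2 * (pi / 12))" by simp
  also have "\<dots> = 1 - 2 * (r / (1 + r))\<^sup>2" unfolding cos_double_sin sin_pi_12_r by simp
  also have "\<dots> = ((1 + r)\<^sup>2 + (1 + r)\<^sup>2 - (r + r)\<^sup>2) / (2 * (1 + r) * (1 + r))"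
    using r_bounds by (simp add: divide_simps) (simp add: algebra_simps power2_eq_square)
  finally have "corona_angle 1 r r = arccos (cos (pi / 6))"
    unfolding corona_angle_def by (simp only:)
  also have "\<dots> = pi / 6" by (intro arccos_cos) auto
  finally show ?thesis .
qed

text \<open>Base angles of the isosceles triangle with apex angle \<open>pi / 6\<close> at the large
  disc.\<close>

lemma corona_angle_small_mixed: "corona_angle r 1 r = 5 * pi / 12" "corona_angle r r 1 = 5 * pi / 12"
proof -
  have "cos (5 * pi / 12) = cos (pi / 2 - pi / 12)" by (rule arg_cong[where f = cos]) simp
  also have "\<dots> = sin (pi / 12)" by (simp only: cos_diff cos_pi_half sin_pi_half mult_zero_left mult_1 add_0)
  finally have c: "cos (5 * pi / 12) = r / (1 + r)" using sin_pi_12_r by simp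
  have "((r + 1)\<^sup>2 + (r + r)\<^sup>2 - (1 + r)\<^sup>2) / (2 * (r + 1) * (r + r)) = cos (5 * pi / 12)"
    "((r + r)\<^sup>2 + (r + 1)\<^sup>2 - (r + 1)\<^sup>2) / (2 * (r + r) * (r + 1)) = cos (5 * pi / 12)"
    unfolding c using r_bounds by (simp add: divide_simps; simp add: algebra_simps power2_eq_square)+
  then show "corona_angle r 1 r = 5 * pi / 12" "corona_angle r r 1 = 5 * pi / 12"
    unfolding corona_angle_def by (simp_all only:) (rule arccos_cos; simp)+
qed

lemma corona_angle_small_large: "corona_angle r 1 1 = pi - 2 * mixed_angle"
proof -
  have "cos (pi - 2 * mixed_angle) = 1 - 2 * (1 / (1 + r))\<^sup>2"
    by (simp only: cos_pi_minus cos_double_cos cos_mixed_angle_r minus_diff_eq)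
  also have "\<dots> = ((r + 1)\<^sup>2 + (r + 1)\<^sup>2 - (1 + 1)\<^sup>2) / (2 * (r + 1) * (r + 1))"
    using r_bounds by (simp add: divide_simps) (simp add: algebra_simps power2_eq_square)
  finally have "corona_angle r 1 1 = arccos (cos (pi - 2 * mixed_angle))"
    unfolding corona_angle_def by (simp only:)
  also have "\<dots> = pi - 2 * mixed_angle"
    using mixed_angle_range by (intro arccos_cos) auto
  finally show ?thesis .
qed

definition large :: "complex set" where "large = {z. (z, 1) \<in> P}"

definition small :: "complex set" where "small = {z. (z, r) \<in> P}"

lemma packing_P: "packing P" and compact_P: "compact_packing P"
  and radius_P: "D \<in> P \<Longrightarrow> radius D = 1 \<or> radius D = r"
  using P by (auto simp: compact_packing_using_def compact_packing_def)

lemma large_nonempty: "\<exists>z. z \<in> large" and small_nonempty: "\<exists>z. z \<in> small"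
  using P by (force simp: compact_packing_using_def large_def small_def)+

lemma small_large_separated: "z \<in> small \<Longrightarrow> w \<in> large \<Longrightarrow> 1 + r \<le> dist z w"
  using packing_separated[OF packing_P, of "(z, r)" "(w, 1)"] r_bounds
  by (simp add: small_def large_def)

lemma large_large_separated: "z \<in> large \<Longrightarrow> w \<in> large \<Longrightarrow> z \<noteq> w \<Longrightarrow> 2 \<le> dist z w"
  using packing_separated[OF packing_P, of "(z, 1)" "(w, 1)"] by (simp add: large_def)

lemma corona_walk:
  assumes D: "D \<in> P" and E: "E \<in> P" "tangent D E"
  obtains n g where "n > 0" "g 0 = E" "\<And>i. g (i + n) = g i" "range g = tangent_discs P D"
    "\<And>i. tangent (g i) (g (Suc i))" "\<And>i. radius (g i) = 1 \<or> radius (g i) = r"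
    "\<And>i. centre (g (Suc i)) - centre D =
       of_real ((radius D + radius (g (Suc i))) / (radius D + radius (g i))) *
       cis (corona_angle (radius D) (radius (g i)) (radius (g (Suc i)))) * (centre (g i) - centre D)"
    "(\<Sum>i<n. corona_angle (radius D) (radius (g i)) (radius (g (Suc i)))) = 2 * pi"
proof -
  have ED: "E \<in> tangent_discs P D" using E by (simp add: tangent_discs_def)
  obtain n g where g: "n > 0" "g 0 = E" "\<And>i. g (i + n) = g i" and rg: "range g = tangent_discs P D"
    and tan: "\<And>i. tangent (g i) (g (Suc i))"
    and sg: "\<And>i. sgn (centre (g (Suc i)) - centre D) =
       cis (triangle_angle (centre D) (centre (g i)) (centre (g (Suc i)))) * sgn (centre (g i) - centre D)"
    and tot: "(\<Sum>i<n. triangle_angle (centre D) (centre (g i)) (centre (g (Suc i)))) = 2 * pi"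
    using corona[OF compact_P D ED] by blast
  have gD: "g i \<in> P" "tangent D (g i)" for i using rg by (auto simp: tangent_discs_def)
  have ang: "triangle_angle (centre D) (centre (g i)) (centre (g (Suc i)))
     = corona_angle (radius D) (radius (g i)) (radius (g (Suc i)))" for i
    using triangle_angle_tangent gD tan by blast
  have v: "norm (centre (g i) - centre D) = radius D + radius (g i)" for i
    using gD(2)[of i] by (simp add: tangent_def dist_norm norm_minus_commute)
  have pos: "radius D + radius (g i) > 0" for i
    using radius_P[OF D] radius_P[OF gD(1)[of i]] r_bounds by auto
  have pol: "centre (g i) - centre D = of_real (radius D + radius (g i)) * sgn (centre (g i) - centre D)" for i
    using pos[of i] v[of i] by (simp add: sgn_eq del: of_real_add)
  have "centre (g (Suc i)) - centre D =
       of_real ((radius D + radius (g (Suc i))) / (radius D + radius (g i))) *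
       cis (corona_angle (radius D) (radius (g i)) (radius (g (Suc i)))) * (centre (g i) - centre D)" for i
  proof -
    have "centre (g (Suc i)) - centre D = of_real (radius D + radius (g (Suc i))) *
       (cis (corona_angle (radius D) (radius (g i)) (radius (g (Suc i)))) * sgn (centre (g i) - centre D))"
      using pol[of "Suc i"] sg[of i] by (simp add: ang)
    moreover have "sgn (centre (g i) - centre D) = (centre (g i) - centre D) / of_real (radius D + radius (g i))"
      by (simp add: sgn_eq v)
    ultimately show ?thesis by (simp del: of_real_add)
  qed
  then show thesis using that[of n g] g rg tan tot radius_P[OF gD(1)] unfolding ang by blast
qed

end

section \<open>Counting pairs over one period\<close>

lemma count_zero:
  fixes p :: "nat \<Rightarrow> bool"
  assumes "(\<Sum>i<n. of_bool (p i)) = (0::nat)" "\<And>i. p (i + n) = p i" "n > 0"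
  shows "\<not> p i"
proof -
  have "p i = p (i mod n)"
  proof -
    have "p (j + k * n) = p j" for j k
      by (induction k) (simp_all add: assms(2) flip: add.assoc, metis add.assoc add.commute assms(2))
    from this[of "i mod n" "i div n"] show ?thesis by (simp add: mod_div_mult_eq)
  qed
  moreover have "\<not> p (i mod n)" using assms(1) mod_less_divisor[OF assms(3), of i] by (auto simp: disjoint_iff)
  ultimately show ?thesis by simp
qed

lemma count_two:
  fixes p :: "nat \<Rightarrow> bool"
  assumes "i < n" "j < n" "i \<noteq> j" "p i" "p j"
  shows "2 \<le> (\<Sum>k<n. of_bool (p k) :: nat)"
proof -
  have "(2::nat) = (\<Sum>k\<in>{i, j}. of_bool (p k))" using assms by simp
  also have "\<dots> \<le> (\<Sum>k<n. of_bool (p k))" using assms by (intro sum_mono2) auto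
  finally show ?thesis .
qed

lemma sum_three_types:
  fixes x y z :: real
  assumes "\<And>i. f i = of_bool (p i) * x + of_bool (q i) * y + of_bool (s i) * z"
  shows "real (\<Sum>i<n. of_bool (p i)) * x + real (\<Sum>i<n. of_bool (q i)) * y
    + real (\<Sum>i<n. of_bool (s i)) * z = (\<Sum>i<n. f i)"
  unfolding assms sum.distrib of_nat_sum sum_distrib_right of_nat_of_bool ..

context two_radius_packing
begin

section \<open>Radius patterns of coronas\<close>

lemma r_not_1: "r \<noteq> 1" "1 \<noteq> r" using r_bounds by auto

text \<open>The discs tangent to the disc with centre \<open>c\<close> and radius \<open>R\<close>, listed around it with period
  \<open>n\<close>, have the centres \<open>c + w i\<close> and the radii \<open>\<rho> i\<close>.\<close>

definition corona_seq :: "complex \<Rightarrow> real \<Rightarrow> nat \<Rightarrow> (nat \<Rightarrow> complex) \<Rightarrow> (nat \<Rightarrow> real) \<Rightarrow> bool" where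
  "corona_seq c R n w \<rho> \<longleftrightarrow> n > 0 \<and> (\<forall>i. w (i + n) = w i) \<and> (\<forall>i. \<rho> (i + n) = \<rho> i) \<and>
     range (\<lambda>i. (c + w i, \<rho> i)) = tangent_discs P (c, R) \<and>
     (\<forall>i. tangent (c + w i, \<rho> i) (c + w (Suc i), \<rho> (Suc i))) \<and>
     (\<forall>i. \<rho> i = 1 \<or> \<rho> i = r) \<and>
     (\<forall>i. w (Suc i) = of_real ((R + \<rho> (Suc i)) / (R + \<rho> i)) * cis (corona_angle R (\<rho> i) (\<rho> (Suc i))) * w i) \<and>
     (\<Sum>i<n. corona_angle R (\<rho> i) (\<rho> (Suc i))) = 2 * pi"

lemma corona_seq_exists:
  assumes "(c, R) \<in> P" "(c + v, s) \<in> P" "norm v = R + s"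
  obtains n w \<rho> where "corona_seq c R n w \<rho>" "w 0 = v" "\<rho> 0 = s"
proof -
  have tan: "tangent (c, R) (c + v, s)" using assms(3) by (simp add: tangent_def dist_norm)
  show thesis
  proof (rule corona_walk[OF assms(1,2) tan])
    fix n g
    assume g: "0 < n" "g 0 = (c + v, s)" "\<And>i. g (i + n) = g i" "range g = tangent_discs P (c, R)"
      "\<And>i. tangent (g i) (g (Suc i))" "\<And>i. radius (g i) = 1 \<or> radius (g i) = r"
      "\<And>i. centre (g (Suc i)) - centre (c, R) =
       of_real ((radius (c, R) + radius (g (Suc i))) / (radius (c, R) + radius (g i))) *
       cis (corona_angle (radius (c, R)) (radius (g i)) (radius (g (Suc i)))) * (centre (g i) - centre (c, R))"
      "(\<Sum>i<n. corona_angle (radius (c, R)) (radius (g i)) (radius (g (Suc i)))) = 2 * pi"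
    have w: "(c + (centre (g i) - c), radius (g i)) = g i" for i by simp
    have "\<forall>i. centre (g (i + n)) - c = centre (g i) - c" "\<forall>i. radius (g (i + n)) = radius (g i)"
      by (simp_all add: g(3))
    then have "corona_seq c R n (\<lambda>i. centre (g i) - c) (\<lambda>i. radius (g i))"
      unfolding corona_seq_def w using g unfolding fst_conv snd_conv by blast
    then show thesis using that g(2) by simp
  qed
qed

lemma corona_seq_mem:
  assumes "corona_seq c R n w \<rho>"
  shows "(c + w i, \<rho> i) \<in> P" "norm (w i) = R + \<rho> i"
proof -
  have "(c + w i, \<rho> i) \<in> tangent_discs P (c, R)" using assms by (auto simp: corona_seq_def)
  then show "(c + w i, \<rho> i) \<in> P" "norm (w i) = R + \<rho> i"
    by (auto simp: tangent_discs_def tangent_def dist_norm)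
qed

lemma corona_seq_tangent:
  assumes "corona_seq c R n w \<rho>"
  shows "norm (w (Suc i) - w i) = \<rho> (Suc i) + \<rho> i"
proof -
  have "tangent (c + w i, \<rho> i) (c + w (Suc i), \<rho> (Suc i))" using assms unfolding corona_seq_def by blast
  then show ?thesis by (simp add: tangent_def dist_norm norm_minus_commute add.commute)
qed

text \<open>\<open>mixed_angle\<close> occurs exactly where the radius changes, and
  \<open>large_count\<close> rules it out.\<close>

lemma large_corona_uniform:
  assumes "corona_seq c 1 n w \<rho>"
  shows "\<rho> i = \<rho> 0"
proof -
  have rad: "\<rho> i = 1 \<or> \<rho> i = r" and per: "\<rho> (i + n) = \<rho> i" and n: "n > 0"
    and tot: "(\<Sum>i<n. corona_angle 1 (\<rho> i) (\<rho> (Suc i))) = 2 * pi" for i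
    using assms by (auto simp: corona_seq_def)
  let ?p = "\<lambda>i. \<rho> i = 1 \<and> \<rho> (Suc i) = 1"
  let ?q = "\<lambda>i. \<rho> i = r \<and> \<rho> (Suc i) = r"
  let ?s = "\<lambda>i. \<rho> i \<noteq> \<rho> (Suc i)"
  have "corona_angle 1 (\<rho> i) (\<rho> (Suc i)) =
      of_bool (?p i) * (pi / 3) + of_bool (?q i) * (pi / 6) + of_bool (?s i) * mixed_angle" for i
    using rad[of i] rad[of "Suc i"] r_not_1
    by (elim disjE) (simp_all add: corona_angle_same corona_angle_large_mixed corona_angle_large_small)
  then have "real (\<Sum>i<n. of_bool (?p i)) * (pi / 3) + real (\<Sum>i<n. of_bool (?q i)) * (pi / 6)
      + real (\<Sum>i<n. of_bool (?s i)) * mixed_angle = 2 * pi"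
    unfolding tot[symmetric] by (rule sum_three_types)
  then have "(\<Sum>i<n. of_bool (?s i)) = (0::nat)" by (rule large_count)
  then have "\<not> ?s i" for i by (rule count_zero) (use n per per[of "Suc i" for i] in auto)
  then show ?thesis by (induction i) auto
qed

text \<open>This reads off \<open>small_count\<close>: \<open>c = 0\<close> keeps large discs apart,
  \<open>b = 0\<close> means that the radius never changes, \<open>a = 1\<close> that exactly one
  pair of consecutive small discs occurs.\<close>

lemma small_corona:
  assumes "corona_seq c r n w \<rho>"
  shows "\<rho> i = 1 \<Longrightarrow> \<rho> (Suc i) = r"
    and "(\<forall>i. \<rho> i = \<rho> 0) \<or> (\<Sum>i<n. of_bool (\<rho> i = r \<and> \<rho> (Suc i) = r)) = (1::nat)"
proof -
  have rad: "\<rho> i = 1 \<or> \<rho> i = r" and per: "\<rho> (i + n) = \<rho> i" and n: "n > 0"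
    and tot: "(\<Sum>i<n. corona_angle r (\<rho> i) (\<rho> (Suc i))) = 2 * pi" for i
    using assms by (auto simp: corona_seq_def)
  let ?p = "\<lambda>i. \<rho> i = r \<and> \<rho> (Suc i) = r"
  let ?q = "\<lambda>i. \<rho> i \<noteq> \<rho> (Suc i)"
  let ?s = "\<lambda>i. \<rho> i = 1 \<and> \<rho> (Suc i) = 1"
  have "corona_angle r (\<rho> i) (\<rho> (Suc i)) =
      of_bool (?p i) * (pi / 3) + of_bool (?q i) * (5 * pi / 12) + of_bool (?s i) * (pi - 2 * mixed_angle)" for i
    using rad[of i] rad[of "Suc i"] r_not_1 r_bounds(1)
    by (elim disjE) (simp_all add: corona_angle_same corona_angle_small_mixed corona_angle_small_large)
  then have "real (\<Sum>i<n. of_bool (?p i)) * (pi / 3) + real (\<Sum>i<n. of_bool (?q i)) * (5 * pi / 12)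
      + real (\<Sum>i<n. of_bool (?s i)) * (pi - 2 * mixed_angle) = 2 * pi"
    unfolding tot[symmetric] by (rule sum_three_types)
  note count = small_count[OF this]
  have "\<not> ?s i" by (rule count_zero[OF count(1)]) (use n per per[of "Suc i" for i] in auto)
  then show "\<rho> i = 1 \<Longrightarrow> \<rho> (Suc i) = r" using rad by blast
  from count(2) show "(\<forall>i. \<rho> i = \<rho> 0) \<or> (\<Sum>i<n. of_bool (?p i)) = (1::nat)"
  proof
    assume "(\<Sum>i<n. of_bool (?q i)) = (0::nat)"
    then have "\<not> ?q i" for i by (rule count_zero) (use n per per[of "Suc i" for i] in auto)
    then have "\<rho> i = \<rho> 0" for i by (induction i) auto
    then show ?thesis by blast
  qed simp
qed

lemma uniform_corona:
  assumes "corona_seq c R n w \<rho>" "\<And>i. \<rho> i = s" "R + s > 0"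
  shows "w k = w 0 * cis (corona_angle R s s) ^ k"
  by (induction k) (use assms in \<open>simp_all add: corona_seq_def\<close>)

lemma hexagonal_corona:
  assumes "corona_seq c R n w \<rho>" "\<And>i. \<rho> i = R" "R > 0"
  shows "(c + w 0 * \<zeta> ^ (2 * k), R) \<in> P"
proof -
  have "cis (pi / 3) = \<zeta> ^ 2" by (subst Complex.DeMoivre) simp
  then have "w k = w 0 * \<zeta> ^ (2 * k)"
    using uniform_corona[OF assms(1,2), of k] assms(3) by (simp add: corona_angle_same power_mult)
  then show ?thesis using corona_seq_mem(1)[OF assms(1), of k] assms(2) by simp
qed

section \<open>Neighbours of large and of small discs\<close>

lemma large_with_large_neighbour:
  assumes c: "c \<in> large" and e: "c + v \<in> large" and v: "norm v = 2"
  shows "c + v * \<zeta> ^ (2 * k) \<in> large"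
proof -
  obtain n w \<rho> where cs: "corona_seq c 1 n w \<rho>" "w 0 = v" "\<rho> 0 = 1"
    using corona_seq_exists[of c 1 v 1] assms by (auto simp: large_def)
  then show ?thesis
    using hexagonal_corona[OF cs(1), of k] large_corona_uniform[OF cs(1)] by (simp add: large_def)
qed

lemma large_with_small_neighbour:
  assumes c: "c \<in> large" and e: "c + v \<in> small" and v: "norm v = 1 + r"
  shows "c + v * \<zeta> ^ k \<in> small"
    and "E \<in> P \<Longrightarrow> tangent (c, 1) E \<Longrightarrow> \<exists>k. E = (c + v * \<zeta> ^ k, r)"
proof -
  obtain n w \<rho> where cs: "corona_seq c 1 n w \<rho>" "w 0 = v" "\<rho> 0 = r"
    using corona_seq_exists[of c 1 v r] assms by (auto simp: large_def small_def)
  then have uni: "\<rho> i = r" for i using large_corona_uniform[OF cs(1)] by simp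
  then have w: "w k = v * \<zeta> ^ k" for k
    using uniform_corona[OF cs(1) uni, of k] cs(2) r_bounds by (simp add: corona_angle_large_small)
  show "c + v * \<zeta> ^ k \<in> small"
    using corona_seq_mem(1)[OF cs(1), of k] by (simp add: small_def uni w)
  show "\<exists>k. E = (c + v * \<zeta> ^ k, r)" if "E \<in> P" "tangent (c, 1) E"
  proof -
    have "E \<in> range (\<lambda>i. (c + w i, \<rho> i))" using that cs(1) by (simp add: corona_seq_def tangent_discs_def)
    then show ?thesis by (auto simp: w uni)
  qed
qed

end

lemma zeta_power_shift: "\<zeta> ^ (k + 6) = - (\<zeta> ^ k)"
  by (simp add: power_add zeta_power_6)

lemma norm_1_minus_zeta_square: "norm (1 - \<zeta> ^ 2) = 1"
proof -
  have "(norm (1 - \<zeta> ^ 2))\<^sup>2 = 1" unfolding zeta_square cmod_power2 by (simp add: power2_eq_square)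
  then show ?thesis using power2_eq_iff_nonneg[of "norm (1 - \<zeta> ^ 2)" 1] by simp
qed

context two_radius_packing
begin

text \<open>In the corona large, small, large, small, small the walk from a large disc reaches the
  next one after 75 + 75 = 150 degrees, past one small disc, or after 75 + 60 + 75 = 210 degrees,
  past two. These are the powers 5 and 7 of \<open>\<zeta>\<close>.\<close>

lemma small_with_large_neighbour_exists:
  assumes e: "e \<in> small" and c: "e + v \<in> large" and v: "norm v = 1 + r"
  shows "e + v * \<zeta> ^ 5 \<in> large \<or> e + v * \<zeta> ^ 7 \<in> large"
proof -
  obtain n w \<rho> where cs: "corona_seq e r n w \<rho>" "w 0 = v" "\<rho> 0 = 1"
    using corona_seq_exists[of e r v 1] assms by (auto simp: large_def small_def add.commute)
  have rad: "\<rho> i = 1 \<or> \<rho> i = r" for i using cs(1) by (simp add: corona_seq_def)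
  have walk: "w (Suc i) = of_real ((r + \<rho> (Suc i)) / (r + \<rho> i)) * cis (corona_angle r (\<rho> i) (\<rho> (Suc i))) * w i" for i
    using cs(1) unfolding corona_seq_def by blast
  have mem: "\<rho> i = 1 \<Longrightarrow> e + w i \<in> large" for i
    using corona_seq_mem(1)[OF cs(1), of i] by (simp add: large_def)
  have scale: "complex_of_real ((r + 1) / (r + r)) * complex_of_real ((r + r) / (r + 1)) = 1"
    unfolding of_real_mult[symmetric] using r_bounds by simp
  have r1: "\<rho> 1 = r" using small_corona(1)[OF cs(1), of 0] cs(3) by simp
  have w1: "w 1 = of_real ((r + r) / (r + 1)) * cis (5 * pi / 12) * v"
    using walk[of 0] cs(2,3) r1 by (simp add: corona_angle_small_mixed)
  show ?thesis
  proof (cases "\<rho> 2 = 1")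
    case True
    have "w 2 = of_real ((r + 1) / (r + r)) * cis (5 * pi / 12) * w 1"
      using walk[of 1] r1 True by (simp add: corona_angle_small_mixed numeral_2_eq_2)
    also have "\<dots> = of_real ((r + 1) / (r + r)) * of_real ((r + r) / (r + 1)) * (cis (5 * pi / 12) * cis (5 * pi / 12)) * v"
      unfolding w1 by (simp only: ac_simps)
    also have "cis (5 * pi / 12) * cis (5 * pi / 12) = \<zeta> ^ 5"
      by (subst Complex.DeMoivre) (simp add: cis_mult)
    finally have "w 2 = v * \<zeta> ^ 5" using scale by (simp add: mult.commute)
    then show ?thesis using mem[of 2] True by simp
  next
    case False
    then have r2: "\<rho> 2 = r" using rad by blast
    have w2: "w 2 = cis (pi / 3) * w 1"
      using walk[of 1] r1 r2 r_bounds by (simp add: corona_angle_same numeral_2_eq_2)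
    have "\<rho> 3 \<noteq> r"
    proof
      assume r3: "\<rho> 3 = r"
      \<comment> \<open>A third small disc would give two small pairs, at 1 and 2, against the
        single one allowed. Both indices lie in one period because \<open>\<rho> n = 1\<close>
        forces \<open>n > 3\<close>.\<close>
      have "\<rho> n = 1" "n > 0" using cs by (auto simp: corona_seq_def dest: spec[of _ 0])
      moreover have "\<rho> (Suc 0) = r" "\<rho> (Suc (Suc 0)) = r" "\<rho> (Suc (Suc (Suc 0))) = r"
        using r1 r2 r3 by (simp_all add: numeral_2_eq_2 numeral_3_eq_3)
      ultimately have "n \<noteq> 0" "n \<noteq> Suc 0" "n \<noteq> Suc (Suc 0)" "n \<noteq> Suc (Suc (Suc 0))"
        using r_not_1 by auto
      then have "2 < n" by simp
      then have "2 \<le> (\<Sum>i<n. of_bool (\<rho> i = r \<and> \<rho> (Suc i) = r) :: nat)"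
        by (intro count_two[of 1 n 2]) (use r1 r2 r3 in \<open>simp_all add: numeral_2_eq_2 numeral_3_eq_3\<close>)
      moreover have "\<rho> 1 \<noteq> \<rho> 0" using r1 cs(3) r_not_1 by simp
      ultimately show False using small_corona(2)[OF cs(1)] by auto
    qed
    then have r3: "\<rho> 3 = 1" using rad by blast
    have "w 3 = of_real ((r + 1) / (r + r)) * cis (5 * pi / 12) * w 2"
      using walk[of 2] r2 r3 by (simp add: corona_angle_small_mixed numeral_2_eq_2 numeral_3_eq_3)
    also have "\<dots> = of_real ((r + 1) / (r + r)) * of_real ((r + r) / (r + 1)) *
        (cis (5 * pi / 12) * cis (pi / 3) * cis (5 * pi / 12)) * v"
      unfolding w2 w1 by (simp only: ac_simps)
    also have "cis (5 * pi / 12) * cis (pi / 3) * cis (5 * pi / 12) = \<zeta> ^ 7"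
      by (subst Complex.DeMoivre) (simp add: cis_mult)
    finally have "w 3 = v * \<zeta> ^ 7" using scale by (simp add: mult.commute)
    then show ?thesis using mem[of 3] r3 by simp
  qed
qed

text \<open>The two positions are seen from \<open>e\<close> under 60 degrees, so they are
  \<open>1 + r\<close> apart, too close for large discs.\<close>

lemma small_with_large_neighbour_unique:
  assumes "norm v = 1 + r" "e + v * \<zeta> ^ 5 \<in> large"
  shows "e + v * \<zeta> ^ 7 \<notin> large"
proof
  assume 7: "e + v * \<zeta> ^ 7 \<in> large"
  have "(e + v * \<zeta> ^ 5) - (e + v * \<zeta> ^ 7) = v * \<zeta> ^ 5 * (1 - \<zeta> ^ 2)"
    by (simp add: algebra_simps flip: power_add)
  then have d: "dist (e + v * \<zeta> ^ 5) (e + v * \<zeta> ^ 7) = 1 + r"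
    unfolding dist_norm by (simp add: norm_mult norm_power norm_1_minus_zeta_square assms(1))
  then have "e + v * \<zeta> ^ 5 \<noteq> e + v * \<zeta> ^ 7" using r_bounds by auto
  then show False using large_large_separated[OF assms(2) 7] d r_bounds by simp
qed

section \<open>Excluding lattices of equal discs\<close>

definition isolated :: "complex set" where
  "isolated = {z \<in> small. \<forall>v. norm v = 1 + r \<longrightarrow> z + v \<notin> large}"

text \<open>The predecessor and successor of \<open>z\<close> in the corona of \<open>z + v\<close>
  touch \<open>z\<close>, hence are small. That gives two small pairs, so the corona is entirely
  small.\<close>

lemma small_neighbour_of_isolated:
  assumes z: "z \<in> isolated" and e: "z + v \<in> small" and v: "norm v = 2 * r"
  shows "z + v \<in> isolated"
proof -
  have zs: "z \<in> small" using z by (simp add: isolated_def)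
  obtain n w \<rho> where cs: "corona_seq (z + v) r n w \<rho>" "w 0 = - v" "\<rho> 0 = r"
    using corona_seq_exists[of "z + v" r "- v" r] zs e v by (auto simp: small_def)
  have rad: "\<rho> i = 1 \<or> \<rho> i = r" for i using cs(1) by (simp add: corona_seq_def)
  have n: "n > 0" "w n = w 0" "\<rho> n = \<rho> 0" using cs(1) by (auto simp: corona_seq_def dest: spec[of _ 0])
  have small: "\<rho> i = r" if "norm (w i + v) = \<rho> i + r" for i
  proof (rule ccontr)
    assume "\<rho> i \<noteq> r"
    then have 1: "\<rho> i = 1" using rad by blast
    then have "z + (w i + v) \<in> large"
      using corona_seq_mem(1)[OF cs(1), of i] by (simp add: large_def algebra_simps)
    then show False using z that 1 by (simp add: isolated_def)
  qed
  have r1: "\<rho> 1 = r"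
    using small[of 1] corona_seq_tangent[OF cs(1), of 0] cs(2,3) by simp
  \<comment> \<open>For \<open>n = 1\<close> the only neighbour would have to touch itself. So the
    pairs at 0 and \<open>n - 1\<close> are distinct.\<close>
  have n1: "n \<noteq> 1"
    using corona_seq_tangent[OF cs(1), of 0] n r_bounds cs(3) by auto
  have rl: "\<rho> (n - 1) = r"
    using small[of "n - 1"] corona_seq_tangent[OF cs(1), of "n - 1"] cs(2,3) n
    by (simp add: norm_minus_commute[of "- v"] add.commute)
  have "2 \<le> (\<Sum>i<n. of_bool (\<rho> i = r \<and> \<rho> (Suc i) = r) :: nat)"
    by (rule count_two[of 0 n "n - 1"]) (use n n1 r1 rl cs(3) in auto)
  then have all: "\<rho> i = r" for i using small_corona(2)[OF cs(1)] cs(3) by auto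
  have "z + v + x \<notin> large" if "norm x = 1 + r" for x
  proof
    assume "z + v + x \<in> large"
    then have "(z + v + x, 1) \<in> tangent_discs P (z + v, r)"
      using that by (simp add: tangent_discs_def tangent_def dist_norm large_def)
    then have "(z + v + x, 1) \<in> range (\<lambda>i. (z + v + w i, \<rho> i))" using cs(1) by (simp add: corona_seq_def)
    then show False using all r_not_1 by auto
  qed
  then show ?thesis using e by (simp add: isolated_def)
qed

lemma isolated_hexagonal:
  assumes z: "z \<in> isolated" and e: "z + v \<in> isolated" and v: "norm v = 2 * r"
  shows "z + v * \<zeta> ^ (2 * k) \<in> isolated"
proof -
  obtain n w \<rho> where cs: "corona_seq z r n w \<rho>" "w 0 = v" "\<rho> 0 = r"
    using corona_seq_exists[of z r v r] z e v by (auto simp: small_def isolated_def)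
  have "\<rho> i = r" for i
  proof -
    have "\<rho> i \<noteq> 1"
      using corona_seq_mem[OF cs(1), of i] z by (auto simp: isolated_def large_def add.commute)
    then show ?thesis using cs(1) by (auto simp: corona_seq_def)
  qed
  then have "z + v * \<zeta> ^ (2 * k) \<in> small"
    using hexagonal_corona[OF cs(1), of k] r_bounds cs(2) by (simp add: small_def)
  then show ?thesis
    by (rule small_neighbour_of_isolated[OF z]) (simp add: norm_mult norm_power v)
qed

text \<open>An empty corona would have angle sum 0.\<close>

lemma tangent_exists:
  assumes "(c, R) \<in> P"
  obtains v s where "(c + v, s) \<in> P" "norm v = R + s" "s = 1 \<or> s = r"
proof -
  obtain Es where "set Es = tangent_discs P (c, R)"
     "(\<Sum>i<length Es. triangle_angle c (centre (Es ! i)) (centre (Es ! (Suc i mod length Es)))) = 2 * pi"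
    using assms compact_P unfolding compact_packing_def by fastforce
  then have "tangent_discs P (c, R) \<noteq> {}" by (cases Es) auto
  then obtain e s where "(e, s) \<in> P" "dist c e = R + s" by (auto simp: tangent_discs_def tangent_def)
  then show thesis using that[of "e - c" s] radius_P by (force simp: dist_norm norm_minus_commute)
qed

text \<open>An isolated disc generates a lattice of isolated ones with spacing \<open>2 * r\<close>,
  with a point within squared distance \<open>7 / 4 * r\<^sup>2 < 7 / 4\<close> of a large centre;
  separation demands at least \<open>1.349\<^sup>2\<close>, about 1.82.\<close>

lemma no_isolated: "z \<notin> isolated"
proof
  assume z: "z \<in> isolated"
  then have "(z, r) \<in> P" by (simp add: isolated_def small_def)
  then obtain v s where s: "(z + v, s) \<in> P" "norm v = r + s" "s = 1 \<or> s = r" by (rule tangent_exists)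
  have "s \<noteq> 1" using z s by (auto simp: isolated_def large_def add.commute)
  then have v: "z + v \<in> small" "norm v = 2 * r" using s by (auto simp: small_def)
  obtain w where w: "w \<in> large" using large_nonempty by blast
  have "v \<noteq> 0" using v r_bounds by auto
  then obtain x where x: "x \<in> isolated" "(norm (w - x))\<^sup>2 \<le> 7 / 16 * (norm v)\<^sup>2"
    using hexagonal_closed_cover[OF z small_neighbour_of_isolated[OF z v], of w] isolated_hexagonal v(2) by auto
  then have "(norm (w - x))\<^sup>2 \<le> 7 / 4 * r\<^sup>2" unfolding v(2) by (simp add: power_mult_distrib)
  also have "\<dots> < 7 / 4" using r_bounds by (simp add: power_less_one_iff)
  finally have "(norm (w - x))\<^sup>2 < 7 / 4" .
  moreover have "1.349 \<le> norm (w - x)"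
    using small_large_separated[of x w] x w r_bounds by (simp add: isolated_def dist_norm norm_minus_commute)
  then have "1.349\<^sup>2 \<le> (norm (w - x))\<^sup>2" by (intro power_mono) auto
  ultimately show False by (simp add: power2_eq_square)
qed

text \<open>Two touching large discs generate a lattice of large discs with spacing 2, and the same
  numbers leave no place for a small centre.\<close>

lemma no_adjacent_large:
  assumes c: "c \<in> large" and v: "norm v = 2"
  shows "c + v \<notin> large"
proof
  assume e: "c + v \<in> large"
  obtain w where w: "w \<in> small" using small_nonempty by blast
  have "v \<noteq> 0" using v by auto
  then obtain x where x: "x \<in> large" "(norm (w - x))\<^sup>2 \<le> 7 / 16 * (norm v)\<^sup>2"
    using hexagonal_closed_cover[OF c e, of w] large_with_large_neighbour v by auto
  then have "1.349 \<le> norm (w - x)"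
    using small_large_separated[of w x] w r_bounds by (simp add: dist_norm)
  then have "1.349\<^sup>2 \<le> (norm (w - x))\<^sup>2" by (intro power_mono) auto
  then show False using x(2) v by (simp add: power2_eq_square)
qed

end

section \<open>The truncated hexagonal pattern\<close>

lemma norm_1_plus_zeta_square: "(norm (1 + \<zeta>))\<^sup>2 = 2 + sqrt 3"
  unfolding cmod_power2 by (simp add: cos_30 sin_30 power2_eq_square algebra_simps)

lemma norm_1_plus_zeta_bound: "(norm (1 + \<zeta>))\<^sup>2 < 3.74"
proof -
  have "sqrt 3 < 1.74" by (rule real_less_lsqrt) (simp_all add: power2_eq_square)
  then show ?thesis unfolding norm_1_plus_zeta_square by simp
qed

definition lattice_point :: "complex \<Rightarrow> complex \<Rightarrow> int \<Rightarrow> int \<Rightarrow> complex" where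
  "lattice_point c s m n = c + s * (1 + \<zeta>) * (of_int m + of_int n * \<zeta> ^ 2)"

text \<open>Here \<open>c\<close> is the centre of a large disc and \<open>c + s\<close> that of one
  of the twelve small discs around it; two of these, adjacent in the ring, have centres \<open>c + s\<close> and
  \<open>c + s \<zeta>\<close>, where \<open>\<zeta>\<close> is the twelfth root of unity, and touch a second large disc, whose centre
  is the reflection \<open>c + s (1 + \<zeta>)\<close> of \<open>c\<close>.\<close>

definition pattern :: "real \<Rightarrow> complex \<Rightarrow> complex \<Rightarrow> disc set" where
  "pattern r c s = {(lattice_point c s m n, 1) | m n. True} \<union>
     {(lattice_point c s m n + s * \<zeta> ^ k, r) | m n k. True}"

section \<open>Seeds and the lattice they generate\<close>

context two_radius_packing
begin

text \<open>The last condition fixes to which of the two alternating classes of ring positions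
  \<open>s\<close> belongs: the pair at \<open>c + s\<close> and \<open>c + s * \<zeta>\<close>
  bridges to a second large disc.\<close>

definition seed :: "complex \<Rightarrow> complex \<Rightarrow> bool" where
  "seed c s \<longleftrightarrow> norm s = 1 + r \<and> c \<in> large \<and> c + s \<in> small \<and> c + s * (1 + \<zeta>) \<in> large"

text \<open>Seen from the small disc at \<open>c + s * \<zeta> ^ Suc k\<close>, which touches the
  one at \<open>c\<close>, the two candidates are the 150 and 210 degree positions, of which exactly
  one is large.\<close>

lemma bridge_alternates:
  assumes c: "c \<in> large" and s: "norm s = 1 + r" and e: "c + s \<in> small"
  shows "c + s * \<zeta> ^ Suc k * (1 + \<zeta>) \<in> large \<longleftrightarrow> c + s * \<zeta> ^ k * (1 + \<zeta>) \<notin> large"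
proof -
  define e where "e = c + s * \<zeta> ^ Suc k"
  define v where "v = - (s * \<zeta> ^ Suc k)"
  have e_small: "e \<in> small" unfolding e_def by (rule large_with_small_neighbour(1)[OF c e s])
  have v: "norm v = 1 + r" by (simp add: v_def norm_mult norm_power s)
  have "e + v \<in> large" using c by (simp add: e_def v_def)
  note bridges = small_with_large_neighbour_exists[OF e_small this v] small_with_large_neighbour_unique[OF v, of e]
  have "v * \<zeta> ^ 5 = - (s * \<zeta> ^ (k + 6))" by (simp add: v_def power_add eval_nat_numeral)
  then have 5: "e + v * \<zeta> ^ 5 = c + s * \<zeta> ^ k * (1 + \<zeta>)"
    unfolding zeta_power_shift by (simp add: e_def algebra_simps)
  have "v * \<zeta> ^ 7 = - (s * \<zeta> ^ (Suc (Suc k) + 6))" by (simp add: v_def power_add eval_nat_numeral)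
  then have 7: "e + v * \<zeta> ^ 7 = c + s * \<zeta> ^ Suc k * (1 + \<zeta>)"
    unfolding zeta_power_shift by (simp add: e_def algebra_simps)
  show ?thesis using bridges unfolding 5 7 by blast
qed

lemma seed_rotate:
  assumes "seed c s"
  shows "seed c (s * \<zeta> ^ (2 * k))"
proof -
  have s: "norm s = 1 + r" "c \<in> large" "c + s \<in> small" using assms by (auto simp: seed_def)
  have "c + s * \<zeta> ^ (2 * k) * (1 + \<zeta>) \<in> large"
  proof (induction k)
    case 0 show ?case using assms by (simp add: seed_def)
  next
    case (Suc k)
    then show ?case using bridge_alternates[OF s(2,1,3), of "2 * k"] bridge_alternates[OF s(2,1,3), of "Suc (2 * k)"]
      by simp
  qed
  then show ?thesis using large_with_small_neighbour(1)[OF s(2,3,1)] s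
    by (simp add: seed_def norm_mult norm_power)
qed

text \<open>Half-turn about the midpoint of the two large centres: it exchanges \<open>c + s\<close>
  and \<open>c + s * \<zeta>\<close>.\<close>

lemma seed_flip:
  assumes "seed c s"
  shows "seed (c + s * (1 + \<zeta>)) (- s)"
proof -
  have "c + s * \<zeta> ^ 1 \<in> small"
    using large_with_small_neighbour(1)[of c s 1] assms unfolding seed_def by blast
  then show ?thesis using assms by (simp add: seed_def algebra_simps)
qed

text \<open>Rotate, flip to the neighbouring large disc, and rotate on:
  \<open>- (\<zeta> ^ 18) = 1\<close> restores \<open>s\<close>.\<close>

lemma seed_translate:
  assumes "seed c s" "k \<le> 9"
  shows "seed (c + s * (1 + \<zeta>) * \<zeta> ^ (2 * k)) s"
proof -
  have "- (s * \<zeta> ^ (2 * k)) * \<zeta> ^ (2 * (9 - k)) = - s * (\<zeta> ^ (2 * k) * \<zeta> ^ (2 * (9 - k)))"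
    by simp
  also have "\<zeta> ^ (2 * k) * \<zeta> ^ (2 * (9 - k)) = \<zeta> ^ (6 * 3)"
    using assms(2) by (subst power_add[symmetric], intro arg_cong[where f = "(^) \<zeta>"]) simp
  also have "- s * \<zeta> ^ (6 * 3) = s" unfolding power_mult zeta_power_6 by simp
  finally show ?thesis
    using seed_rotate[OF seed_flip[OF seed_rotate[OF assms(1), of k]], of "9 - k"]
    by (simp add: mult_ac)
qed

lemma seed_lattice:
  assumes "seed c s"
  shows "seed (lattice_point c s m n) s"
  unfolding lattice_point_def
proof (rule lattice_closed[where A = "\<lambda>c. seed c s"])
  fix z assume z: "seed z s"
  have "\<zeta> ^ 8 = - (\<zeta> ^ 2)" using zeta_power_shift[of 2] by simp
  then show "seed (z + s * (1 + \<zeta>)) s \<and> seed (z - s * (1 + \<zeta>)) s \<and>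
      seed (z + s * (1 + \<zeta>) * \<zeta> ^ 2) s \<and> seed (z - s * (1 + \<zeta>) * \<zeta> ^ 2) s"
    using seed_translate[OF z, of 0] seed_translate[OF z, of 3] seed_translate[OF z, of 1]
      seed_translate[OF z, of 4] zeta_power_6 by simp
qed (fact assms)

text \<open>Every lattice point is a large centre, and one of them is closer than 2 to
  \<open>w\<close>: the squared bound \<open>7 / 16 * (1 + r)\<^sup>2 * (2 + sqrt 3)\<close> is just
  under 3. Separation forces equality.\<close>

lemma large_eq_lattice:
  assumes "seed c s" "w \<in> large"
  shows "\<exists>m n. w = lattice_point c s m n"
proof -
  have s: "norm s = 1 + r" using assms by (simp add: seed_def)
  have "s * (1 + \<zeta>) \<noteq> 0"
  proof
    assume "s * (1 + \<zeta>) = 0"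
    then have "s = 0 \<or> norm (1 + \<zeta>) = 0" by auto
    moreover have "2 + sqrt 3 > 0" by (simp add: add_pos_nonneg)
    ultimately show False using s r_bounds norm_1_plus_zeta_square by auto
  qed
  then obtain m n where mn: "(norm (w - lattice_point c s m n))\<^sup>2 \<le> 7 / 16 * (norm (s * (1 + \<zeta>)))\<^sup>2"
    unfolding lattice_point_def using lattice_cover by blast
  have "(norm (s * (1 + \<zeta>)))\<^sup>2 = (1 + r)\<^sup>2 * (norm (1 + \<zeta>))\<^sup>2"
    by (simp add: norm_mult power_mult_distrib s)
  also have "\<dots> \<le> 1.35\<^sup>2 * 3.74"
    using r_bounds norm_1_plus_zeta_bound by (intro mult_mono power_mono) auto
  finally have "(norm (w - lattice_point c s m n))\<^sup>2 < 2\<^sup>2" using mn by (simp add: power2_eq_square)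
  then have "norm (w - lattice_point c s m n) < 2" by (rule power2_less_imp_less) simp
  moreover have "lattice_point c s m n \<in> large" using seed_lattice[OF assms(1)] by (simp add: seed_def)
  ultimately have "w = lattice_point c s m n"
    using large_large_separated[OF assms(2)] by (fastforce simp: dist_norm)
  then show ?thesis by blast
qed

lemma packing_eq_pattern:
  assumes "seed c s"
  shows "P = pattern r c s"
proof
  have s: "seed (lattice_point c s m n) s" for m n using assms by (rule seed_lattice)
  show "pattern r c s \<subseteq> P"
    using s large_with_small_neighbour(1) unfolding pattern_def seed_def
    by (auto simp: large_def small_def)
  show "P \<subseteq> pattern r c s"
  proof
    fix D assume D: "D \<in> P"
    obtain w q where Dq: "D = (w, q)" by fastforce
    consider "q = 1" | "q = r" using radius_P[OF D] Dq by auto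
    then show "D \<in> pattern r c s"
    proof cases
      case 1
      then show ?thesis using large_eq_lattice[OF assms, of w] D Dq by (auto simp: large_def pattern_def)
    next
      case 2
      then have "w \<in> small" using D Dq by (simp add: small_def)
      then obtain v where v: "norm v = 1 + r" "w + v \<in> large" using no_isolated by (auto simp: isolated_def)
      then obtain m n where mn: "w + v = lattice_point c s m n" using large_eq_lattice[OF assms] by blast
      have "tangent (w + v, 1) D" using v Dq 2 by (simp add: tangent_def dist_norm)
      then have "\<exists>k. D = (w + v + s * \<zeta> ^ k, r)"
        using large_with_small_neighbour(2)[of "w + v" s D] D s[of m n] unfolding mn seed_def by blast
      then show ?thesis unfolding mn pattern_def by blast
    qed
  qed
qed

lemma seed_exists: "\<exists>c s. seed c s"
proof -
  obtain c where c: "c \<in> large" using large_nonempty by blast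
  then have "(c, 1) \<in> P" by (simp add: large_def)
  then obtain v s where s: "(c + v, s) \<in> P" "norm v = 1 + s" "s = 1 \<or> s = r" by (rule tangent_exists)
  have "s \<noteq> 1" using no_adjacent_large[OF c, of v] s by (auto simp: large_def)
  then have v: "c + v \<in> small" "norm v = 1 + r" using s by (auto simp: small_def)
  have "c + v * \<zeta> ^ 1 \<in> small" by (rule large_with_small_neighbour(1)[OF c v])
  \<comment> \<open>Of two consecutive pairs of the ring, one bridges to a large disc; that pair
    gives the seed.\<close>
  then have "seed c v \<or> seed c (v * \<zeta>)" using bridge_alternates[OF c v(2,1), of 0] c v
    by (auto simp: seed_def norm_mult)
  then show ?thesis by blast
qed

end

section \<open>Isometry between two patterns\<close>

lemma isometry_disc_set:
  assumes "plane_isometry f"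
  shows "f ` disc_set (z, q) = disc_set (f z, q)"
proof -
  have d: "dist (f x) (f y) = dist x y" for x y using assms by (simp add: plane_isometry_def)
  have "y \<in> f ` cball z q" if "dist (f z) y \<le> q" for y
  proof -
    obtain x where x: "y = f x" using assms by (metis plane_isometry_def bij_pointE)
    then show ?thesis using that d by auto
  qed
  then show ?thesis by (auto simp: disc_set_def d)
qed

text \<open>\<open>s' / s\<close> has modulus 1, so multiplying by it is a rotation; it matches
  lattice points and rings index by index.\<close>

lemma pattern_isometric:
  assumes s: "norm s = norm s'" "s \<noteq> 0"
  shows "\<exists>f. plane_isometry f \<and> (\<lambda>D. f ` disc_set D) ` pattern r c s = disc_set ` pattern r c' s'"
proof -
  define a where "a = s' / s"
  define f where "f z = c' + a * (z - c)" for z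
  have a: "norm a = 1" "a \<noteq> 0" "a * s = s'" using s by (auto simp: a_def norm_divide)
  have "bij f"
    by (rule bij_betw_byWitness[where f' = "\<lambda>z. c + (z - c') / a"]) (use a in \<open>auto simp: f_def\<close>)
  moreover have "dist (f x) (f y) = dist x y" for x y
  proof -
    have "f x - f y = a * (x - y)" by (simp add: f_def algebra_simps)
    then show ?thesis by (simp add: dist_norm norm_mult a)
  qed
  ultimately have iso: "plane_isometry f" by (simp add: plane_isometry_def)
  have l: "f (lattice_point c s m n) = lattice_point c' s' m n" for m n
    by (simp add: f_def lattice_point_def flip: a(3))
  have l2: "f (lattice_point c s m n + s * \<zeta> ^ k) = lattice_point c' s' m n + s' * \<zeta> ^ k" for m n k
    unfolding l[symmetric] by (simp add: f_def algebra_simps flip: a(3))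
  have "(\<lambda>D. f ` disc_set D) ` pattern r c s = disc_set ` (\<lambda>D. (f (fst D), snd D)) ` pattern r c s"
  proof -
    have "f ` disc_set D = disc_set (f (fst D), snd D)" for D
      using isometry_disc_set[OF iso, of "fst D" "snd D"] by simp
    then show ?thesis by (simp add: image_image)
  qed
  also have "(\<lambda>D. (f (fst D), snd D)) ` pattern r c s = pattern r c' s'"
    unfolding pattern_def image_Un
    by (intro arg_cong2[where f = "(\<union>)"]) (force simp: l l2)+
  finally show ?thesis using iso by blast
qed

theorem mainTheorem2:
  fixes r :: real and P Q :: "disc set"
  assumes "r = sin (pi / 12) / (1 - sin (pi / 12))"
    and "compact_packing_using 1 r P"
    and "compact_packing_using 1 r Q"
  shows "\<exists>f. plane_isometry f \<and> (\<lambda>D. f ` disc_set D) ` P = disc_set ` Q"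
proof -
  interpret P: two_radius_packing r P using assms by unfold_locales
  interpret Q: two_radius_packing r Q using assms by unfold_locales
  obtain c s where s: "P.seed c s" using P.seed_exists by blast
  obtain c' s' where s': "Q.seed c' s'" using Q.seed_exists by blast
  have "norm s = 1 + r" "norm s' = 1 + r" using s s' by (auto simp: P.seed_def Q.seed_def)
  then show ?thesis
    unfolding P.packing_eq_pattern[OF s] Q.packing_eq_pattern[OF s']
    using P.r_bounds by (intro pattern_isometric) auto
qed

end
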